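(* Let $F$ be a field, $m\ge 1$, $I=\{1,\dots,m\}$. For each associative binary operation $a\in\mathcal O_m$ on $I$, the algebra $\mathfrak C_a$ of cubic matrices over $F$ is commutative if and only if $m=1$.
   Context: $\mathcal O_m$ denotes the set of all associative binary operations $a\colon I\times I\to I$. $\mathfrak C$ is the $m^3$-dimensional $F$-vector space of cubic matrices $A=(a_{ijk})_{i,j,k=1}^m$ with entries in $F$ (entrywise addition and scalar multiplication), with standard basis $E_{ijk}$, $i,j,k\in I$ (the $(i,j,k)$ entry of $E_{ijk}$ is $1$ and all others are $0$). For $a\in\mathcal O_m$, the multiplication $*_a$ on $\mathfrak C$ is the bilinear extension of $$E_{ijk}*_aE_{lnr}=\delta_{kl}\,E_{i\,a(j,n)\,r},$$ where $\delta_{kl}$ is the Kronecker symbol, and $\mathfrak C_a=(\mathfrak C,*_a)$. *)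

theory Defs
  imports Complex_Main "HOL-Library.FuncSet" "HOL-Library.Function_Algebras"
begin

text \<open>
  Cubic matrices are functions of three indices that vanish unless all indices lie in
  \<open>{1..m}\<close>.  Their entrywise addition is the pointwise addition of functions from
  \<open>HOL-Library.Function_Algebras\<close>.
\<close>

type_synonym 'f cubic = "nat \<Rightarrow> nat \<Rightarrow> nat \<Rightarrow> 'f"

definition idx :: "nat \<Rightarrow> nat set" where
  "idx m = {1..m}"

text \<open>Extensional functions, so that each operation on the index set is represented once.\<close>

definition assoc_ops :: "nat \<Rightarrow> (nat \<times> nat \<Rightarrow> nat) set" where
  "assoc_ops m = {a \<in> idx m \<times> idx m \<rightarrow>\<^sub>E idx m.
     \<forall>i\<in>idx m. \<forall>j\<in>idx m. \<forall>k\<in>idx m. a (a (i, j), k) = a (i, a (j, k))}"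

definition cubic_matrices :: "nat \<Rightarrow> 'f::field cubic set" where
  "cubic_matrices m = {A. \<forall>i j k. \<not> (i \<in> idx m \<and> j \<in> idx m \<and> k \<in> idx m) \<longrightarrow> A i j k = 0}"

definition cubic_scale :: "'f::field \<Rightarrow> 'f cubic \<Rightarrow> 'f cubic" where
  "cubic_scale c A = (\<lambda>i j k. c * A i j k)"

definition cubic_E :: "nat \<Rightarrow> nat \<Rightarrow> nat \<Rightarrow> 'f::field cubic" where
  "cubic_E i j k = (\<lambda>p q r. if p = i \<and> q = j \<and> r = k then 1 else 0)"

definition cubic_E_mult ::
  "(nat \<times> nat \<Rightarrow> nat) \<Rightarrow> nat \<times> nat \<times> nat \<Rightarrow> nat \<times> nat \<times> nat \<Rightarrow> 'f::field cubic" where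
  "cubic_E_mult a = (\<lambda>(i, j, k) (l, n, r). if k = l then cubic_E i (a (j, n)) r else 0)"

text \<open>
  The bilinear extension of \<^const>\<open>cubic_E_mult\<close>: the entries of a cubic matrix are its
  coordinates in the standard basis.
\<close>

definition cubic_mult ::
  "nat \<Rightarrow> (nat \<times> nat \<Rightarrow> nat) \<Rightarrow> 'f::field cubic \<Rightarrow> 'f cubic \<Rightarrow> 'f cubic" where
  "cubic_mult m a A B =
     (\<Sum>(i, j, k) \<in> idx m \<times> idx m \<times> idx m. \<Sum>(l, n, r) \<in> idx m \<times> idx m \<times> idx m.
        cubic_scale (A i j k * B l n r) (cubic_E_mult a (i, j, k) (l, n, r)))"

definition cubic_algebra_commutative ::
  "'f::field itself \<Rightarrow> nat \<Rightarrow> (nat \<times> nat \<Rightarrow> nat) \<Rightarrow> bool" where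
  "cubic_algebra_commutative F m a \<longleftrightarrow>
     (\<forall>A \<in> (cubic_matrices m :: 'f cubic set). \<forall>B \<in> cubic_matrices m.
        cubic_mult m a A B = cubic_mult m a B A)"

interpretation cubic: vector_space "cubic_scale :: 'f::field \<Rightarrow> 'f cubic \<Rightarrow> 'f cubic"
  by unfold_locales (auto simp: cubic_scale_def fun_eq_iff algebra_simps)

lemma subspace_cubic_matrices: "cubic.subspace (cubic_matrices m)"
  by (auto simp: cubic.subspace_def cubic_matrices_def cubic_scale_def)

lemma cubic_E_in_cubic_matrices:
  "i \<in> idx m \<Longrightarrow> j \<in> idx m \<Longrightarrow> k \<in> idx m \<Longrightarrow> cubic_E i j k \<in> cubic_matrices m"
  by (auto simp: cubic_matrices_def cubic_E_def)

lemma sum_cubic_apply: "(\<Sum>x\<in>S. f x :: 'f::field cubic) i j k = (\<Sum>x\<in>S. f x i j k)"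
  by (induction S rule: infinite_finite_induct) auto

lemma cubic_matrix_expansion:
  assumes "A \<in> cubic_matrices m"
  shows "A = (\<Sum>(i, j, k) \<in> idx m \<times> idx m \<times> idx m. cubic_scale (A i j k) (cubic_E i j k))"
proof (intro ext)
  fix p q r
  have "(\<Sum>x \<in> idx m \<times> idx m \<times> idx m.
      (case x of (i, j, k) \<Rightarrow> cubic_scale (A i j k) (cubic_E i j k)) p q r)
    = (\<Sum>x \<in> idx m \<times> idx m \<times> idx m. if x = (p, q, r) then A p q r else 0)"
    by (intro sum.cong) (auto simp: cubic_scale_def cubic_E_def split: if_splits)
  also have "\<dots> = A p q r"
    using assms by (auto simp: cubic_matrices_def idx_def)
  finally show "A p q r =
      (\<Sum>(i, j, k) \<in> idx m \<times> idx m \<times> idx m. cubic_scale (A i j k) (cubic_E i j k)) p q r"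
    by (simp add: sum_cubic_apply)
qed

lemma cubic_mult_in_cubic_matrices:
  assumes "a \<in> assoc_ops m"
  shows "cubic_mult m a A B \<in> cubic_matrices m"
proof -
  have "a (j, n) \<in> idx m" if "j \<in> idx m" "n \<in> idx m" for j n
    using assms that by (auto simp: assoc_ops_def PiE_iff)
  then show ?thesis
    unfolding cubic_mult_def
    by (auto intro!: cubic.subspace_sum cubic.subspace_scale subspace_cubic_matrices
        cubic.subspace_0 cubic_E_in_cubic_matrices simp: cubic_E_mult_def)
qed

lemma cubic_mult_linear:
  "cubic_mult m a (A + A') B = cubic_mult m a A B + cubic_mult m a A' B"
  "cubic_mult m a A (B + B') = cubic_mult m a A B + cubic_mult m a A B'"
  "cubic_mult m a (cubic_scale c A) B = cubic_scale c (cubic_mult m a A B)"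
  "cubic_mult m a A (cubic_scale c B) = cubic_scale c (cubic_mult m a A B)"
  by (simp_all add: cubic_mult_def case_prod_unfold distrib_left distrib_right sum.distrib
      cubic.scale_left_distrib cubic.scale_sum_right)
    (simp_all add: cubic_scale_def ac_simps)

lemma cubic_mult_cubic_E:
  assumes "i \<in> idx m" "j \<in> idx m" "k \<in> idx m" "l \<in> idx m" "n \<in> idx m" "r \<in> idx m"
  shows "cubic_mult m a (cubic_E i j k) (cubic_E l n r) =
    (if k = l then cubic_E i (a (j, n)) r else 0)"
proof -
  have fin: "finite (idx m \<times> idx m \<times> idx m)"
    by (simp add: idx_def)
  have "cubic_mult m a (cubic_E i j k) (cubic_E l n r) =
    (\<Sum>x \<in> idx m \<times> idx m \<times> idx m. \<Sum>y \<in> idx m \<times> idx m \<times> idx m.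
       if y = (l, n, r) then (if x = (i, j, k) then cubic_E_mult a (i, j, k) (l, n, r) else 0)
       else 0)"
    unfolding cubic_mult_def case_prod_unfold
    by (intro sum.cong refl) (auto simp: cubic_E_def prod_eq_iff split: if_splits)
  also have "\<dots> = cubic_E_mult a (i, j, k) (l, n, r)"
    using fin assms by simp
  finally show ?thesis
    by (simp add: cubic_E_mult_def)
qed

end

theory Submission
  imports Defs
begin

text \<open>
  In the outer indices the basis matrices multiply like matrix units: \<open>E\<^sub>i\<^sub>j\<^sub>k * E\<^sub>l\<^sub>n\<^sub>r\<close> vanishes
  unless \<open>k = l\<close>, whatever \<open>a\<close> does to the middle indices.  As soon as there are two distinct
  outer indices, commutativity therefore fails as it does for ordinary matrices:
  \<open>E\<^sub>1\<^sub>1\<^sub>2 * E\<^sub>2\<^sub>1\<^sub>2\<close> is a basis matrix, while \<open>E\<^sub>2\<^sub>1\<^sub>2 * E\<^sub>1\<^sub>1\<^sub>2 = 0\<close>.  For \<open>m = 1\<close> the algebra is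
  one-dimensional, and every bilinear product on a line is commutative.
\<close>

lemma cubic_E_nonzero: "(cubic_E i j k :: 'f::field cubic) \<noteq> 0"
proof
  assume "(cubic_E i j k :: 'f cubic) = 0"
  then have "(cubic_E i j k :: 'f cubic) i j k = 0"
    by simp
  then show False
    by (simp add: cubic_E_def)
qed

lemma cubic_mult_size_one_commute: "cubic_mult 1 a A B = cubic_mult 1 a B A"
  by (simp add: cubic_mult_def idx_def mult.commute)

text \<open>
  The two factors share their last index, so that one product is composable in the outer indices
  and the other is not.
\<close>

lemma cubic_E_not_commute:
  assumes "i \<in> idx m" "j \<in> idx m" "k \<in> idx m" "i \<noteq> k"
  shows "cubic_mult m a (cubic_E i j k) (cubic_E k j k :: 'f::field cubic)
    \<noteq> cubic_mult m a (cubic_E k j k) (cubic_E i j k)"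
  using assms by (simp add: cubic_mult_cubic_E cubic_E_nonzero)

theorem proposition6p1:
  fixes m :: nat and a :: "nat \<times> nat \<Rightarrow> nat"
  assumes "m \<ge> 1" and "a \<in> assoc_ops m"
  shows "cubic_algebra_commutative TYPE('f::field) m a \<longleftrightarrow> m = 1"
proof
  assume comm: "cubic_algebra_commutative TYPE('f) m a"
  show "m = 1"
  proof (rule ccontr)
    assume "m \<noteq> 1"
    with \<open>m \<ge> 1\<close> have mem: "1 \<in> idx m" "2 \<in> idx m"
      by (auto simp: idx_def)
    then have "cubic_mult m a (cubic_E 1 1 2) (cubic_E 2 1 2 :: 'f cubic)
        = cubic_mult m a (cubic_E 2 1 2) (cubic_E 1 1 2)"
      using comm by (simp add: cubic_algebra_commutative_def cubic_E_in_cubic_matrices)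
    moreover have "cubic_mult m a (cubic_E 1 1 2) (cubic_E 2 1 2 :: 'f cubic)
        \<noteq> cubic_mult m a (cubic_E 2 1 2) (cubic_E 1 1 2)"
      using mem by (intro cubic_E_not_commute) auto
    ultimately show False
      by contradiction
  qed
next
  assume "m = 1"
  then show "cubic_algebra_commutative TYPE('f) m a"
    unfolding cubic_algebra_commutative_def using cubic_mult_size_one_commute by blast
qed

end
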